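(* Let $\mathcal{H},\widetilde{\mathcal{H}},\mathcal{U},\widetilde{\mathcal{U}}$ be Banach spaces, let $-H$ and $-\widetilde H$ be infinitesimal generators of $C_0$-semigroups on $\mathcal{H}$ and $\widetilde{\mathcal{H}}$, respectively, and let $B\colon\mathcal{U}\to\mathcal{H}$ and $\widetilde B\colon\widetilde{\mathcal{U}}\to\widetilde{\mathcal{H}}$ be bounded linear operators. Let $T>0$ and $p\in[1,\infty]$. Suppose that there is a bounded linear operator $Y\colon\widetilde{\mathcal{H}}\to\mathcal{H}$ with a bounded right inverse $\hat Y\colon\mathcal{H}\to\widetilde{\mathcal{H}}$ such that $Y\widetilde H\subset HY$, that is, $Yg\in\mathcal{D}(H)$ and $Y\widetilde Hg=HYg$ for all $g\in\mathcal{D}(\widetilde H)$. Furthermore, suppose that for some bounded linear operator $Z\colon\widetilde{\mathcal{U}}\to\mathcal{U}$ one has $Y\widetilde B=BZ$. If the system $$\partial_t\widetilde u(t)+\widetilde H\widetilde u(t)=\widetilde B\widetilde v(t)\quad\text{for }0<t<T,\qquad\widetilde u(0)=\widetilde u_0,$$ with $\widetilde u_0\in\widetilde{\mathcal{H}}$ and $\widetilde v\in L^1((0,T),\widetilde{\mathcal{U}})$ is null-controllable in time $T>0$ with respect to $L^p((0,T),\widetilde{\mathcal{U}})$ with control cost $\widetilde C_{T,p}>0$, then also the system $$\partial_tu(t)+Hu(t)=Bv(t)\quad\text{for }0<t<T,\qquad u(0)=u_0,$$ with $u_0\in\mathcal{H}$ and $v\in L^1((0,T),\mathcal{U})$ is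 null-controllable in time $T>0$ with respect to $L^p((0,T),\mathcal{U})$ with control cost $C_{T,p}>0$ satisfying $$C_{T,p}\le\|\hat Y\|_{\mathcal{H}\to\widetilde{\mathcal{H}}}\,\|Z\|_{\widetilde{\mathcal{U}}\to\mathcal{U}}\cdot\widetilde C_{T,p}.$$
   Context: $\mathcal{D}(\cdot)$ denotes the domain of an operator. Let $-H$ generate the $C_0$-semigroup $(S(t))_{t\ge0}$ on $\mathcal{H}$ and let $B\colon\mathcal{U}\to\mathcal{H}$ be bounded linear. The system $\partial_tu(t)+Hu(t)=Bv(t)$, $0<t<T$, $u(0)=u_0$, with $u_0\in\mathcal{H}$ and $v\in L^1((0,T),\mathcal{U})$, is called null-controllable in time $T>0$ with respect to $L^p((0,T),\mathcal{U})$, $p\in[1,\infty]$, if for every $u_0\in\mathcal{H}$ there is $v\in L^p((0,T),\mathcal{U})$ with $$(\ast)\qquad S(T)u_0+\int_0^TS(T-s)Bv(s)\,ds=0,$$ that is, if the mild solution vanishes at time $T$. The associated control cost in time $T$ is then $C_{T,p}:=\sup_{\|u_0\|_{\mathcal{H}}=1}\inf\{\|v\|_{L^p((0,T),\mathcal{U})}\colon v\text{ satisfies }(\ast)\}<\infty$. The same definitions apply to the system with tildes (with the semigroup generated by $-\widetilde H$), giving $\widetilde C_{T,p}$.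
   Formalization: The strict positivity of the control cost C_{T,p} is asserted only when S(T) is not the zero operator; if S(T)=0 (e.g. a nilpotent semigroup, or the zero space) the zero control works and C_{T,p}=0, so the claim fails there. *)

theory Defs
  imports "HOL-Probability.Essential_Supremum"
begin

section \<open>Bochner integration without separability\<close>

text \<open>
  The library's Bochner integral is restricted to second countable (separable) target spaces. Here
  the target is an arbitrary normed space, so measurability means strong measurability: being an
  a.e. limit of simple functions. All uses below are over the complete measure
  \<open>lebesgue_on {0<..<T}\<close>.
\<close>

definition strongly_measurable :: "'a measure \<Rightarrow> ('a \<Rightarrow> 'b::real_normed_vector) \<Rightarrow> bool" where
  "strongly_measurable M f \<longleftrightarrow>
     (\<exists>s :: nat \<Rightarrow> 'a \<Rightarrow> 'b. (\<forall>i. simple_function M (s i)) \<and>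
        (AE x in M. (\<lambda>i. s i x) \<longlonglongrightarrow> f x))"

text \<open>
  As in the library's \<open>has_bochner_integral\<close>, with strong in place of Borel measurability.
\<close>

definition has_strong_integral ::
  "'a measure \<Rightarrow> ('a \<Rightarrow> 'b::real_normed_vector) \<Rightarrow> 'b \<Rightarrow> bool" where
  "has_strong_integral M f x \<longleftrightarrow>
     strongly_measurable M f \<and>
     (\<exists>s :: nat \<Rightarrow> 'a \<Rightarrow> 'b. (\<forall>i. Bochner_Integration.simple_bochner_integrable M (s i)) \<and>
        (\<lambda>i. \<integral>\<^sup>+ t. ennreal (norm (f t - s i t)) \<partial>M) \<longlonglongrightarrow> 0 \<and>
        (\<lambda>i. Bochner_Integration.simple_bochner_integral M (s i)) \<longlonglongrightarrow> x)"

definition Lp_norm :: "ennreal \<Rightarrow> 'a measure \<Rightarrow> ('a \<Rightarrow> 'b::real_normed_vector) \<Rightarrow> ennreal" where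
  "Lp_norm p M f =
     (if p = \<infinity> then esssup M (\<lambda>x. ennreal (norm (f x)))
      else let I = \<integral>\<^sup>+ x. ennreal (norm (f x) powr enn2real p) \<partial>M
           in if I = \<infinity> then \<infinity> else ennreal (enn2real I powr (1 / enn2real p)))"

text \<open>
  The elements are functions rather than classes modulo a.e. equality; everything below is
  invariant under a.e. changes.
\<close>

definition Lp_space :: "ennreal \<Rightarrow> 'a measure \<Rightarrow> ('a \<Rightarrow> 'b::real_normed_vector) set" where
  "Lp_space p M = {f. strongly_measurable M f \<and> Lp_norm p M f < \<infinity>}"

section \<open>Operator semigroups\<close>

text \<open>Only the values \<open>S t\<close> with \<open>t \<ge> 0\<close> matter.\<close>

definition C0_semigroup :: "(real \<Rightarrow> 'h::banach \<Rightarrow>\<^sub>L 'h) \<Rightarrow> bool" where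
  "C0_semigroup S \<longleftrightarrow>
     S 0 = id_blinfun \<and>
     (\<forall>s\<ge>0. \<forall>t\<ge>0. S (s + t) = S s o\<^sub>L S t) \<and>
     (\<forall>x. ((\<lambda>t. blinfun_apply (S t) x) \<longlongrightarrow> x) (at_right 0))"

text \<open>
  An unbounded operator is given by its domain \<open>D\<close> and a function \<open>A\<close> whose values outside \<open>D\<close> are
  irrelevant.
\<close>

definition generates ::
  "'h set \<Rightarrow> ('h \<Rightarrow> 'h) \<Rightarrow> (real \<Rightarrow> 'h::banach \<Rightarrow>\<^sub>L 'h) \<Rightarrow> bool" where
  "generates D A S \<longleftrightarrow>
     C0_semigroup S \<and>
     D = {x. \<exists>y. ((\<lambda>t. (blinfun_apply (S t) x - x) /\<^sub>R t) \<longlongrightarrow> y) (at_right 0)} \<and>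
     (\<forall>x\<in>D. ((\<lambda>t. (blinfun_apply (S t) x - x) /\<^sub>R t) \<longlongrightarrow> A x) (at_right 0))"

section \<open>Null-controllability\<close>

text \<open>
  The mild solution with initial value \<open>u0\<close> and control \<open>v\<close> vanishes at time \<open>T\<close>. For
  \<open>v\<close> in \<open>L\<^sup>1\<close> the integral always exists, so asserting its existence excludes no control.
\<close>

definition steers_to_zero ::
  "(real \<Rightarrow> 'h::banach \<Rightarrow>\<^sub>L 'h) \<Rightarrow> ('u::banach \<Rightarrow>\<^sub>L 'h) \<Rightarrow> real \<Rightarrow> 'h \<Rightarrow> (real \<Rightarrow> 'u) \<Rightarrow> bool" where
  "steers_to_zero S B T u0 v \<longleftrightarrow>
     (\<exists>J. has_strong_integral (lebesgue_on {0<..<T})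
            (\<lambda>s. blinfun_apply (S (T - s)) (blinfun_apply B (v s))) J \<and>
          blinfun_apply (S T) u0 + J = 0)"

definition null_controllable ::
  "(real \<Rightarrow> 'h::banach \<Rightarrow>\<^sub>L 'h) \<Rightarrow> ('u::banach \<Rightarrow>\<^sub>L 'h) \<Rightarrow> real \<Rightarrow> ennreal \<Rightarrow> bool" where
  "null_controllable S B T p \<longleftrightarrow>
     (\<forall>u0. \<exists>v\<in>Lp_space p (lebesgue_on {0<..<T}). steers_to_zero S B T u0 v)"

text \<open>
  Supremum and infimum are taken in \<open>[0, \<infinity>]\<close>. In particular the cost is \<open>0\<close> on the zero space,
  whose unit sphere is empty.
\<close>

definition control_cost ::
  "(real \<Rightarrow> 'h::banach \<Rightarrow>\<^sub>L 'h) \<Rightarrow> ('u::banach \<Rightarrow>\<^sub>L 'h) \<Rightarrow> real \<Rightarrow> ennreal \<Rightarrow> ennreal" where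
  "control_cost S B T p =
     (SUP u0\<in>{u0. norm u0 = 1}.
        INF v\<in>{v \<in> Lp_space p (lebesgue_on {0<..<T}). steers_to_zero S B T u0 v}.
          Lp_norm p (lebesgue_on {0<..<T}) v)"

end

theory Submission
  imports Defs
begin

text \<open>
  The operator \<open>Y\<close> intertwines the semigroups: for \<open>g\<close> in the domain of \<open>H'\<close> the curve
  \<open>s \<mapsto> S (t - s) (Y (S' s g))\<close> is constant, and that domain is dense. Hence \<open>Y\<close> maps a
  trajectory of the second system with control \<open>v\<close> to a trajectory of the first one with
  control \<open>Z v\<close>. A given initial value \<open>u0\<close> is \<open>Y (Yhat u0)\<close>, so steering \<open>Yhat u0\<close> to zero
  steers \<open>u0\<close> to zero, at a cost multiplied by at most \<open>\<parallel>Yhat\<parallel> \<parallel>Z\<parallel>\<close>. Finally, a vanishing cost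
  means that \<open>S T u0\<close> is the limit of integrals \<open>\<integral> S (T - s) (B (v s)) ds\<close> with \<open>v\<close> tending to
  zero in \<open>L\<^sup>p\<close>, hence in \<open>L\<^sup>1\<close>; so \<open>S T = 0\<close>.
\<close>

section \<open>Strong measurability and strong integrals\<close>

text \<open>Preimages under \<open>f\<close> and \<open>g\<close> differ by a subset of a null set,
  which completeness makes measurable. This matters because strong measurability controls a function
  only almost everywhere.\<close>

lemma (in complete_measure) measurable_cong_AE:
  assumes f: "f \<in> measurable M N" and ae: "AE x in M. f x = g x"
    and g: "g \<in> space M \<rightarrow> space N"
  shows "g \<in> measurable M N"
proof (rule measurableI)
  fix x assume "x \<in> space M" then show "g x \<in> space N" using g by auto
next
  fix A assume A: "A \<in> sets N"
  show "g -` A \<inter> space M \<in> sets M"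
  proof (rule in_sets_AE)
    show "AE x in M. x \<in> f -` A \<inter> space M \<longleftrightarrow> x \<in> g -` A \<inter> space M"
      using ae by eventually_elim auto
    show "f -` A \<inter> space M \<in> sets M" using f A by (rule measurable_sets)
  qed auto
qed

lemma complete_measure_lebesgue_on:
  assumes "S \<in> sets lebesgue"
  shows "complete_measure (lebesgue_on S)"
proof
  fix A B :: "'a set" assume "B \<subseteq> A" and A: "A \<in> null_sets (lebesgue_on S)"
  moreover have "A \<in> null_sets lebesgue" "A \<subseteq> S"
    using A assms by (auto simp: null_sets_restrict_space)
  ultimately have "B \<in> null_sets lebesgue" "B \<subseteq> S"
    using completion.complete2[of B A lborel] by blast+
  then show "B \<in> sets (lebesgue_on S)"
    using assms by (auto simp: sets_restrict_space_iff)
qed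

lemma strongly_measurable_compose:
  assumes f: "strongly_measurable M f" and L: "continuous_on UNIV L"
  shows "strongly_measurable M (\<lambda>x. L (f x))"
proof -
  obtain s where s: "\<And>i. simple_function M (s i)" "AE x in M. (\<lambda>i. s i x) \<longlonglongrightarrow> f x"
    using f unfolding strongly_measurable_def by auto
  have "AE x in M. (\<lambda>i. L (s i x)) \<longlonglongrightarrow> L (f x)"
    using s(2) by eventually_elim (simp add: continuous_on_tendsto_compose[OF L])
  moreover have "simple_function M (\<lambda>x. L (s i x))" for i
    using s(1) by (rule simple_function_compose1)
  ultimately show ?thesis
    unfolding strongly_measurable_def by (intro exI[of _ "\<lambda>i x. L (s i x)"]) simp
qed

lemma strongly_measurable_blinfun:
  "strongly_measurable M f \<Longrightarrow> strongly_measurable M (\<lambda>x. blinfun_apply L (f x))"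
  by (rule strongly_measurable_compose[where L = "blinfun_apply L"])
    (simp_all add: linear_continuous_on blinfun.bounded_linear_right)

lemma strongly_measurable_diff_simple:
  assumes f: "strongly_measurable M f" and g: "simple_function M g"
  shows "strongly_measurable M (\<lambda>x. f x - g x)"
proof -
  obtain s where s: "\<And>i. simple_function M (s i)" "AE x in M. (\<lambda>i. s i x) \<longlonglongrightarrow> f x"
    using f unfolding strongly_measurable_def by auto
  have "AE x in M. (\<lambda>i. s i x - g x) \<longlonglongrightarrow> f x - g x"
    using s(2) by eventually_elim (rule tendsto_diff[OF _ tendsto_const])
  moreover have "simple_function M (\<lambda>x. s i x - g x)" for i
    using s(1) g by (rule simple_function_compose2)
  ultimately show ?thesis
    unfolding strongly_measurable_def by (intro exI[of _ "\<lambda>i x. s i x - g x"]) simp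
qed

text \<open>The norms of the simple approximants converge a.e. to \<open>norm (f x)\<close>, and
  completeness absorbs the exceptional set. All nonnegative integrals below involve vector-valued
  functions through their norms only.\<close>

lemma borel_measurable_strongly_measurable_norm:
  assumes M: "complete_measure M" and f: "strongly_measurable M f"
  shows "(\<lambda>x. norm (f x)) \<in> borel_measurable M"
proof -
  obtain s where s: "\<And>i. simple_function M (s i)" "AE x in M. (\<lambda>i. s i x) \<longlonglongrightarrow> f x"
    using f unfolding strongly_measurable_def by auto
  have [measurable]: "(\<lambda>x. norm (s i x)) \<in> borel_measurable M" for i
    by (rule borel_measurable_simple_function[OF simple_function_compose1[OF s(1)]])
  \<comment> \<open>\<open>lim\<close> is total, with an unspecified value where the norms diverge;
    this can happen only on a null set.\<close>
  have ae: "AE x in M. lim (\<lambda>i. norm (s i x)) = norm (f x)"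
    using s(2) by eventually_elim (rule limI[OF tendsto_norm])
  have "(\<lambda>x. lim (\<lambda>i. norm (s i x))) \<in> borel_measurable M"
    by measurable
  from complete_measure.measurable_cong_AE[OF M this ae] show ?thesis
    by simp
qed

section \<open>Strong integrals under bounded operators and norm bounds\<close>

text \<open>Composing with \<open>L\<close> turns simple approximants of \<open>f\<close> into
  simple approximants of the new integrand: the L^1 error grows by at most the factor
  \<open>norm L\<close>, and integrals of simple functions commute with \<open>L\<close>.\<close>

lemma has_strong_integral_blinfun:
  fixes L :: "'b::real_normed_vector \<Rightarrow>\<^sub>L 'c::real_normed_vector"
  assumes M: "complete_measure M" and f: "has_strong_integral M f J"
  shows "has_strong_integral M (\<lambda>x. blinfun_apply L (f x)) (blinfun_apply L J)"
proof -
  obtain s where fm: "strongly_measurable M f"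
    and s: "\<And>i. Bochner_Integration.simple_bochner_integrable M (s i)"
      "(\<lambda>i. \<integral>\<^sup>+ t. ennreal (norm (f t - s i t)) \<partial>M) \<longlonglongrightarrow> 0"
      "(\<lambda>i. Bochner_Integration.simple_bochner_integral M (s i)) \<longlonglongrightarrow> J"
    using f unfolding has_strong_integral_def by auto
  have sf: "simple_function M (s i)" for i
    using s(1)[of i] by (auto elim: simple_bochner_integrable.cases)
  have [measurable]: "(\<lambda>t. norm (f t - s i t)) \<in> borel_measurable M" for i
    by (intro borel_measurable_strongly_measurable_norm M strongly_measurable_diff_simple fm sf)
  have bnd: "(\<integral>\<^sup>+ t. ennreal (norm (L (f t) - L (s i t))) \<partial>M)
      \<le> ennreal (norm L) * (\<integral>\<^sup>+ t. ennreal (norm (f t - s i t)) \<partial>M)" for i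
  proof -
    have "(\<integral>\<^sup>+ t. ennreal (norm (L (f t) - L (s i t))) \<partial>M)
      \<le> (\<integral>\<^sup>+ t. ennreal (norm L) * ennreal (norm (f t - s i t)) \<partial>M)"
      by (intro nn_integral_mono)
        (simp add: norm_blinfun flip: ennreal_mult blinfun.diff_right)
    also have "\<dots> = ennreal (norm L) * (\<integral>\<^sup>+ t. ennreal (norm (f t - s i t)) \<partial>M)"
      by (intro nn_integral_cmult) measurable
    finally show ?thesis .
  qed
  have "(\<lambda>i. ennreal (norm L) * (\<integral>\<^sup>+ t. ennreal (norm (f t - s i t)) \<partial>M)) \<longlonglongrightarrow> ennreal (norm L) * 0"
    by (intro ennreal_tendsto_cmult s(2)) simp
  then have "(\<lambda>i. ennreal (norm L) * (\<integral>\<^sup>+ t. ennreal (norm (f t - s i t)) \<partial>M)) \<longlonglongrightarrow> 0"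
    by simp
  then have lim: "(\<lambda>i. \<integral>\<^sup>+ t. ennreal (norm (L (f t) - L (s i t))) \<partial>M) \<longlonglongrightarrow> 0"
    by (rule tendsto_sandwich[OF _ _ tendsto_const, rotated 2]) (auto intro: bnd always_eventually)
  have "Bochner_Integration.simple_bochner_integral M (\<lambda>x. L (s i x))
      = L (Bochner_Integration.simple_bochner_integral M (s i))" for i
    by (intro simple_bochner_integral_linear s(1) bounded_linear.linear blinfun.bounded_linear_right)
  then have "(\<lambda>i. Bochner_Integration.simple_bochner_integral M (\<lambda>x. L (s i x))) \<longlonglongrightarrow> L J"
    by (simp add: blinfun.tendsto[OF tendsto_const s(3)])
  moreover have "Bochner_Integration.simple_bochner_integrable M (\<lambda>x. L (s i x))" for i
    using simple_bochner_integrable_compose2[of "\<lambda>x y. L x" M "s i" "s i"] s(1) by simp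
  moreover have "strongly_measurable M (\<lambda>x. L (f x))"
    by (rule strongly_measurable_blinfun[OF fm])
  ultimately show ?thesis
    using lim unfolding has_strong_integral_def
    by (intro conjI exI[of _ "\<lambda>i x. L (s i x)"]) auto
qed

lemma has_strong_integral_cong:
  assumes "\<And>x. x \<in> space M \<Longrightarrow> f x = g x"
  shows "has_strong_integral M f J \<longleftrightarrow> has_strong_integral M g J"
proof -
  have "strongly_measurable M f \<longleftrightarrow> strongly_measurable M g"
    unfolding strongly_measurable_def using assms by (auto cong: AE_cong)
  moreover have "(\<integral>\<^sup>+ t. ennreal (norm (f t - s t)) \<partial>M) = (\<integral>\<^sup>+ t. ennreal (norm (g t - s t)) \<partial>M)" for s
    using assms by (intro nn_integral_cong) simp
  ultimately show ?thesis
    unfolding has_strong_integral_def by simp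
qed

text \<open>For simple functions this is the triangle inequality for finite sums. Replacing an
  approximant by \<open>f\<close> costs their L^1 distance, which vanishes in the limit.\<close>

lemma has_strong_integral_norm_bound:
  assumes M: "complete_measure M" and f: "has_strong_integral M f J"
  shows "ennreal (norm J) \<le> (\<integral>\<^sup>+ t. ennreal (norm (f t)) \<partial>M)"
proof -
  obtain s where fm: "strongly_measurable M f"
    and s: "\<And>i. Bochner_Integration.simple_bochner_integrable M (s i)"
      "(\<lambda>i. \<integral>\<^sup>+ t. ennreal (norm (f t - s i t)) \<partial>M) \<longlonglongrightarrow> 0"
      "(\<lambda>i. Bochner_Integration.simple_bochner_integral M (s i)) \<longlonglongrightarrow> J"
    using f unfolding has_strong_integral_def by auto
  have sf: "simple_function M (s i)" for i
    using s(1)[of i] by (auto elim: simple_bochner_integrable.cases)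
  have [measurable]: "(\<lambda>t. norm (f t - s i t)) \<in> borel_measurable M" for i
    by (intro borel_measurable_strongly_measurable_norm M strongly_measurable_diff_simple fm sf)
  have [measurable]: "(\<lambda>t. norm (f t)) \<in> borel_measurable M"
    by (intro borel_measurable_strongly_measurable_norm M fm)
  have bnd: "ennreal (norm (Bochner_Integration.simple_bochner_integral M (s i)))
      \<le> (\<integral>\<^sup>+ t. ennreal (norm (f t - s i t)) \<partial>M) + (\<integral>\<^sup>+ t. ennreal (norm (f t)) \<partial>M)" for i
  proof -
    have si: "Bochner_Integration.simple_bochner_integrable M (\<lambda>x. norm (s i x))"
      using simple_bochner_integrable_compose2[of "\<lambda>x y. norm x" M "s i" "s i"] s(1) by simp
    have "ennreal (norm (Bochner_Integration.simple_bochner_integral M (s i)))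
      \<le> ennreal (Bochner_Integration.simple_bochner_integral M (\<lambda>x. norm (s i x)))"
      by (intro ennreal_leI simple_bochner_integral_norm_bound s(1))
    also have "\<dots> = (\<integral>\<^sup>+ t. ennreal (norm (s i t)) \<partial>M)"
      using si by (rule simple_bochner_integral_eq_nn_integral) simp
    also have "\<dots> \<le> (\<integral>\<^sup>+ t. ennreal (norm (f t - s i t)) + ennreal (norm (f t)) \<partial>M)"
      by (intro nn_integral_mono)
        (simp flip: ennreal_plus, metis add.commute norm_minus_commute norm_triangle_sub)
    also have "\<dots> = (\<integral>\<^sup>+ t. ennreal (norm (f t - s i t)) \<partial>M) + (\<integral>\<^sup>+ t. ennreal (norm (f t)) \<partial>M)"
      by (intro nn_integral_add) measurable
    finally show ?thesis .
  qed
  have "(\<lambda>i. (\<integral>\<^sup>+ t. ennreal (norm (f t - s i t)) \<partial>M) + (\<integral>\<^sup>+ t. ennreal (norm (f t)) \<partial>M))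
      \<longlonglongrightarrow> 0 + (\<integral>\<^sup>+ t. ennreal (norm (f t)) \<partial>M)"
    by (intro tendsto_add s(2) tendsto_const)
  moreover have "(\<lambda>i. ennreal (norm (Bochner_Integration.simple_bochner_integral M (s i)))) \<longlonglongrightarrow> ennreal (norm J)"
    by (intro tendsto_ennrealI tendsto_norm s(3))
  ultimately show ?thesis
    using bnd by (metis (no_types, lifting) add_0 LIMSEQ_le)
qed

section \<open>\<open>L\<^sup>p\<close> norms\<close>

lemma Lp_norm_blinfun:
  fixes L :: "'b::real_normed_vector \<Rightarrow>\<^sub>L 'c::real_normed_vector"
  assumes M: "complete_measure M" and p: "1 \<le> p" and v: "v \<in> Lp_space p M"
  shows "Lp_norm p M (\<lambda>x. blinfun_apply L (v x)) \<le> ennreal (norm L) * Lp_norm p M v"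
proof -
  have vm: "strongly_measurable M v" and fin: "Lp_norm p M v < \<infinity>"
    using v by (auto simp: Lp_space_def)
  have [measurable]: "(\<lambda>x. norm (v x)) \<in> borel_measurable M"
    by (intro borel_measurable_strongly_measurable_norm M vm)
  have Lm [measurable]: "(\<lambda>x. norm (L (v x))) \<in> borel_measurable M"
    by (intro borel_measurable_strongly_measurable_norm M strongly_measurable_blinfun vm)
  show ?thesis
  proof (cases "p = \<infinity>")
    case True
    have "AE x in M. ennreal (norm (v x)) \<le> esssup M (\<lambda>x. ennreal (norm (v x)))"
      by (rule esssup_AE)
    then have "AE x in M. ennreal (norm (L (v x))) \<le> ennreal (norm L) * esssup M (\<lambda>x. ennreal (norm (v x)))"
    proof eventually_elim
      case (elim x)
      have "ennreal (norm (L (v x))) \<le> ennreal (norm L) * ennreal (norm (v x))"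
        by (simp add: norm_blinfun flip: ennreal_mult)
      also have "\<dots> \<le> ennreal (norm L) * esssup M (\<lambda>x. ennreal (norm (v x)))"
        by (intro mult_left_mono elim) simp
      finally show ?case .
    qed
    then show ?thesis
      using True by (auto simp: Lp_norm_def intro!: esssup_I)
  next
    case False
    define q where "q = enn2real p"
    have q: "q \<ge> 1"
      using p False unfolding q_def by (cases p) (auto simp: top_unique)
    define I where "I = (\<integral>\<^sup>+ x. ennreal (norm (v x) powr q) \<partial>M)"
    define I' where "I' = (\<integral>\<^sup>+ x. ennreal (norm (L (v x)) powr q) \<partial>M)"
    have I: "I \<noteq> \<infinity>" "Lp_norm p M v = ennreal (enn2real I powr (1 / q))"
      using False fin by (auto simp: Lp_norm_def I_def q_def Let_def split: if_splits)
    have "I' \<le> (\<integral>\<^sup>+ x. ennreal (norm L powr q) * ennreal (norm (v x) powr q) \<partial>M)"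
      unfolding I'_def
    proof (intro nn_integral_mono)
      fix x
      have "norm (L (v x)) powr q \<le> (norm L * norm (v x)) powr q"
        using q by (intro powr_mono2 norm_blinfun) auto
      then show "ennreal (norm (L (v x)) powr q) \<le> ennreal (norm L powr q) * ennreal (norm (v x) powr q)"
        by (simp add: powr_mult flip: ennreal_mult)
    qed
    also have "\<dots> = ennreal (norm L powr q) * I"
      unfolding I_def by (intro nn_integral_cmult) measurable
    finally have le: "I' \<le> ennreal (norm L powr q) * I" .
    \<comment> \<open>\<open>enn2real\<close> sends \<infinity> to 0, so it is monotone only below
      \<infinity>; finiteness has to be secured before passing to real numbers.\<close>
    have fin': "ennreal (norm L powr q) * I < \<infinity>"
      using I(1) by (simp add: ennreal_mult_less_top less_top)
    then have I': "I' \<noteq> \<infinity>"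
      using le by (auto simp: top_unique)
    have "enn2real I' \<le> norm L powr q * enn2real I"
      using enn2real_mono[OF le] fin' by (simp add: enn2real_mult)
    then have "enn2real I' powr (1 / q) \<le> (norm L powr q * enn2real I) powr (1 / q)"
      using q by (intro powr_mono2) auto
    also have "\<dots> = norm L * enn2real I powr (1 / q)"
      using q by (simp add: powr_mult powr_powr)
    finally show ?thesis
      using False I I' by (simp add: Lp_norm_def I'_def q_def Let_def flip: ennreal_mult)
  qed
qed

lemma Lp_space_blinfun:
  fixes L :: "'b::real_normed_vector \<Rightarrow>\<^sub>L 'c::real_normed_vector"
  assumes M: "complete_measure M" and p: "1 \<le> p" and v: "v \<in> Lp_space p M"
  shows "(\<lambda>x. blinfun_apply L (v x)) \<in> Lp_space p M"
proof -
  have "ennreal (norm L) * Lp_norm p M v < \<infinity>"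
    using v by (simp add: Lp_space_def ennreal_mult_less_top)
  moreover have "strongly_measurable M (\<lambda>x. L (v x))"
    using v by (simp add: Lp_space_def strongly_measurable_blinfun)
  ultimately show ?thesis
    using Lp_norm_blinfun[OF assms, of L] by (auto simp: Lp_space_def intro: le_less_trans)
qed

text \<open>Continuity at zero of the embedding of L^p into L^1 over a finite measure. In place of
  Hoelder's inequality, finite exponents use
  \<open>x \<le> \<eta> + \<eta> powr (1 - q) * x powr q\<close>: if \<open>x > \<eta>\<close>, then
  \<open>x / \<eta> > 1\<close> is at most its \<open>q\<close>-th power.\<close>

lemma L1_small_if_Lp_small:
  assumes M: "complete_measure M" and finM: "finite_measure M" and p: "1 \<le> p" and \<delta>: "\<delta> > 0"
  obtains \<epsilon> :: real where "\<epsilon> > 0"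
    "\<And>v :: 'a \<Rightarrow> 'b::real_normed_vector. v \<in> Lp_space p M \<Longrightarrow> Lp_norm p M v < ennreal \<epsilon> \<Longrightarrow>
      (\<integral>\<^sup>+ x. ennreal (norm (v x)) \<partial>M) \<le> ennreal \<delta>"
proof -
  define m where "m = measure M (space M)"
  have m: "m \<ge> 0" "emeasure M (space M) = ennreal m"
    using finM by (auto simp: m_def finite_measure.emeasure_eq_measure)
  \<comment> \<open>The constant \<open>\<eta>\<close> integrates to at most
    \<open>\<delta> / 2\<close>; the summand 1 keeps the denominator positive when
    \<open>m = 0\<close>.\<close>
  define \<eta> where "\<eta> = \<delta> / (2 * (m + 1))"
  have \<eta>: "\<eta> > 0" "\<eta> * m \<le> \<delta> / 2"
    using \<delta> m(1) by (auto simp: \<eta>_def field_simps)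
  show ?thesis
  proof (cases "p = \<infinity>")
    case True
    have "(\<integral>\<^sup>+ x. ennreal (norm (v x)) \<partial>M) \<le> ennreal \<delta>"
      if "Lp_norm p M v < ennreal \<eta>" for v :: "'a \<Rightarrow> 'b"
    proof -
      have "AE x in M. ennreal (norm (v x)) \<le> esssup M (\<lambda>x. ennreal (norm (v x)))"
        by (rule esssup_AE)
      then have "AE x in M. ennreal (norm (v x)) \<le> ennreal \<eta>"
      proof eventually_elim
        case (elim x)
        with that True show ?case by (auto simp: Lp_norm_def)
      qed
      then have "(\<integral>\<^sup>+ x. ennreal (norm (v x)) \<partial>M) \<le> (\<integral>\<^sup>+ x. ennreal \<eta> \<partial>M)"
        by (rule nn_integral_mono_AE)
      also have "\<dots> = ennreal (\<eta> * m)"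
        using \<eta> m by (simp add: ennreal_mult)
      also have "\<dots> \<le> ennreal \<delta>"
        using \<eta> \<delta> by (intro ennreal_leI) simp
      finally show ?thesis .
    qed
    then show ?thesis by (rule that[OF \<eta>(1)])
  next
    case False
    define q where "q = enn2real p"
    have q: "q \<ge> 1"
      using p False unfolding q_def by (cases p) (auto simp: top_unique)
    define c where "c = \<eta> powr (1 - q)"
    have c: "c > 0" using \<eta> by (simp add: c_def)
    \<comment> \<open>Solves \<open>c * \<epsilon> powr q = \<delta> / 2\<close>, so that the power
      term contributes at most the other half of \<open>\<delta>\<close>.\<close>
    define \<epsilon> where "\<epsilon> = (\<delta> / (2 * c)) powr (1 / q)"
    have \<epsilon>: "\<epsilon> > 0" using \<delta> c by (simp add: \<epsilon>_def)
    have young: "x \<le> \<eta> + c * x powr q" if "x \<ge> 0" for x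
    proof (cases "x \<le> \<eta>")
      case True
      then show ?thesis using c by (simp add: add_increasing2)
    next
      case False
      then have "x / \<eta> \<ge> 1" using \<eta> by simp
      then have "x / \<eta> \<le> (x / \<eta>) powr q"
        using powr_mono[of 1 q "x / \<eta>"] q \<eta> that by simp
      then have "\<eta> * (x / \<eta>) \<le> \<eta> * (x / \<eta>) powr q"
        using \<eta> by (intro mult_left_mono) auto
      then have "x \<le> \<eta> * (x / \<eta>) powr q"
        using \<eta> by simp
      also have "\<dots> = c * x powr q"
        using \<eta> that by (simp add: c_def powr_divide powr_diff)
      finally show ?thesis using \<eta> by simp
    qed
    have "(\<integral>\<^sup>+ x. ennreal (norm (v x)) \<partial>M) \<le> ennreal \<delta>"
      if v: "v \<in> Lp_space p M" "Lp_norm p M v < ennreal \<epsilon>" for v :: "'a \<Rightarrow> 'b"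
    proof -
      have [measurable]: "(\<lambda>x. norm (v x)) \<in> borel_measurable M"
        using v by (intro borel_measurable_strongly_measurable_norm M) (simp add: Lp_space_def)
      define I where "I = (\<integral>\<^sup>+ x. ennreal (norm (v x) powr q) \<partial>M)"
      have I: "I \<noteq> \<infinity>" "Lp_norm p M v = ennreal (enn2real I powr (1 / q))"
        using False v by (auto simp: Lp_norm_def I_def q_def Let_def Lp_space_def split: if_splits)
      have le: "enn2real I powr (1 / q) \<le> (\<delta> / (2 * c)) powr (1 / q)"
        using v(2) I \<epsilon> by (simp add: \<epsilon>_def ennreal_less_iff)
      have "(enn2real I powr (1 / q)) powr q \<le> ((\<delta> / (2 * c)) powr (1 / q)) powr q"
        by (rule powr_mono2[OF _ _ le]) (use q in auto)
      moreover have "(enn2real I powr (1 / q)) powr q = enn2real I"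
        "((\<delta> / (2 * c)) powr (1 / q)) powr q = \<delta> / (2 * c)"
        using q \<delta> c by (simp_all add: powr_powr)
      ultimately have "enn2real I \<le> \<delta> / (2 * c)" by simp
      then have "c * enn2real I \<le> \<delta> / 2"
        using c by (simp add: field_simps)
      then have *: "\<eta> * m + c * enn2real I \<le> \<delta>"
        using \<eta> by simp
      have "(\<integral>\<^sup>+ x. ennreal (norm (v x)) \<partial>M)
          \<le> (\<integral>\<^sup>+ x. ennreal \<eta> + ennreal c * ennreal (norm (v x) powr q) \<partial>M)"
        using c \<eta> young
        by (intro nn_integral_mono) (simp flip: ennreal_mult ennreal_plus)
      also have "\<dots> = ennreal \<eta> * ennreal m + ennreal c * I"
        unfolding I_def by (simp add: nn_integral_add nn_integral_cmult m)
      also have "\<dots> = ennreal (\<eta> * m + c * enn2real I)"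
        using I(1) \<eta> c m by (simp add: ennreal_mult ennreal_plus less_top)
      also have "\<dots> \<le> ennreal \<delta>"
        using * by (rule ennreal_leI)
      finally show ?thesis .
    qed
    then show ?thesis by (rule that[OF \<epsilon>])
  qed
qed

section \<open>Semigroups and generators\<close>

text \<open>The closed sets \<open>A k\<close> exhaust a Banach space, so by Baire's theorem one of
  them contains a ball. There the whole family is bounded by \<open>k\<close>, and linearity turns
  this into a bound on the operator norms.\<close>

lemma uniform_boundedness:
  fixes L :: "'i \<Rightarrow> 'a::banach \<Rightarrow>\<^sub>L 'b::real_normed_vector"
  assumes pointwise: "\<And>x. \<exists>K. \<forall>i\<in>I. norm (blinfun_apply (L i) x) \<le> K"
  shows "\<exists>K. \<forall>i\<in>I. norm (L i) \<le> K"
proof -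
  define A where "A k = {x. \<forall>i\<in>I. norm (L i x) \<le> real k}" for k :: nat
  have closed: "closed (A k)" for k
  proof -
    have "A k = (\<Inter>i\<in>I. {x. norm (L i x) \<le> real k})"
      by (auto simp: A_def)
    moreover have "closed {x. norm (L i x) \<le> real k}" for i
      by (intro closed_Collect_le continuous_intros)
    ultimately show ?thesis by (simp add: closed_INT)
  qed
  have "x \<in> \<Union> (range A)" for x
  proof -
    obtain K where "\<forall>i\<in>I. norm (L i x) \<le> K" using pointwise by blast
    moreover obtain k :: nat where "K \<le> real k" using real_arch_simple by blast
    ultimately have "x \<in> A k" by (force simp: A_def)
    then show ?thesis by blast
  qed
  then have "\<Union> (range A) = UNIV" by blast
  then have "interior (\<Union> (range A)) \<noteq> {}" by simp
  moreover have "interior (\<Union> (range A)) = {}" if "\<And>k. interior (A k) = {}"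
  proof -
    have "Met_TC.mtopology interior_of \<Union> (range A) = {}"
      using that closed by (intro Met_TC.metric_Baire_category_alt) (auto simp: complete_UNIV)
    then show ?thesis by simp
  qed
  ultimately obtain k a where "a \<in> interior (A k)" by blast
  then obtain r where r: "r > 0" "cball a r \<subseteq> A k"
    by (meson interior_subset mem_interior_cball)
  have "norm (L i) \<le> 2 * real k / r" if i: "i \<in> I" for i
  proof (rule norm_blinfun_bound)
    show "0 \<le> 2 * real k / r" using r by simp
    fix x
    show "norm (L i x) \<le> 2 * real k / r * norm x"
    proof (cases "x = 0")
      case False
      \<comment> \<open>\<open>c\<close> scales \<open>x\<close> to length \<open>r\<close>, so
        \<open>a\<close> and \<open>a + c *\<^sub>R x\<close> both lie in the ball; their images
        differ by \<open>c\<close> times the image of \<open>x\<close>.\<close>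
      define c where "c = r / norm x"
      have c: "c > 0" using False r by (simp add: c_def)
      have "a + c *\<^sub>R x \<in> cball a r" using False r by (simp add: c_def dist_norm)
      moreover have "a \<in> cball a r" using r by simp
      ultimately have "norm (L i (a + c *\<^sub>R x)) \<le> real k" "norm (L i a) \<le> real k"
        using r(2) i unfolding A_def by blast+
      then have "norm (L i (a + c *\<^sub>R x) - L i a) \<le> 2 * real k"
        using norm_triangle_ineq4[of "L i (a + c *\<^sub>R x)" "L i a"] by simp
      then have "c * norm (L i x) \<le> 2 * real k"
        using c by (simp add: blinfun.bilinear_simps)
      then show ?thesis
        using r False by (simp add: c_def field_simps)
    qed simp
  qed
  then show ?thesis by blast
qed

section \<open>Local boundedness and strong continuity of semigroups\<close>

lemma C0_semigroup_id: "C0_semigroup S \<Longrightarrow> S 0 = id_blinfun"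
  by (simp add: C0_semigroup_def)

lemma C0_semigroup_add:
  "C0_semigroup S \<Longrightarrow> s \<ge> 0 \<Longrightarrow> t \<ge> 0 \<Longrightarrow> S (s + t) = S s o\<^sub>L S t"
  by (simp add: C0_semigroup_def)

lemma C0_semigroup_add_apply:
  "C0_semigroup S \<Longrightarrow> s \<ge> 0 \<Longrightarrow> t \<ge> 0 \<Longrightarrow> S (s + t) x = S s (S t x)"
  by (simp add: C0_semigroup_add)

lemma C0_semigroup_commute:
  "C0_semigroup S \<Longrightarrow> s \<ge> 0 \<Longrightarrow> t \<ge> 0 \<Longrightarrow> S s (S t x) = S t (S s x)"
  by (metis C0_semigroup_add_apply add.commute)

lemma C0_semigroup_at_0:
  assumes S: "C0_semigroup S"
  shows "((\<lambda>t. blinfun_apply (S t) x) \<longlongrightarrow> x) (at 0 within {0..})"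
  using S by (simp add: C0_semigroup_def at_within_Ici_at_right)

text \<open>The times may equal 0, so the limit is taken within the closed half line, where
  \<open>S 0\<close> is the identity, and not along the punctured filter
  \<open>at_right 0\<close>.\<close>

lemma C0_semigroup_seq:
  assumes S: "C0_semigroup S" and h: "\<And>n. h n \<ge> 0" "h \<longlonglongrightarrow> 0"
  shows "(\<lambda>n. blinfun_apply (S (h n)) x) \<longlonglongrightarrow> x"
proof -
  have "continuous (at 0 within {0..}) (\<lambda>t. blinfun_apply (S t) x)"
    using C0_semigroup_at_0[OF S, of x] C0_semigroup_id[OF S] by (simp add: continuous_within)
  from continuous_within_tendsto_compose'[OF this _ h(2)] show ?thesis
    using h(1) C0_semigroup_id[OF S] by simp
qed

text \<open>Otherwise there are times \<open>h n\<close> tending to 0 with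
  \<open>norm (S (h n)) > n\<close>. Since \<open>S (h n) x\<close> converges for each
  \<open>x\<close>, the family is pointwise bounded, against the uniform boundedness
  principle.\<close>

lemma C0_semigroup_bounded_near_0:
  assumes S: "C0_semigroup S"
  obtains \<delta> K where "\<delta> > 0" "\<And>t. 0 \<le> t \<Longrightarrow> t \<le> \<delta> \<Longrightarrow> norm (S t) \<le> K"
proof -
  have "\<exists>\<delta>>0. \<exists>K. \<forall>t. 0 \<le> t \<and> t \<le> \<delta> \<longrightarrow> norm (S t) \<le> K"
  proof (rule ccontr)
    assume neg: "\<not> ?thesis"
    have "\<exists>t. 0 \<le> t \<and> t \<le> inverse (real (Suc n)) \<and> norm (S t) > real n" for n
    proof -
      have "inverse (real (Suc n)) > 0" by simp
      then have "\<not> (\<forall>t. 0 \<le> t \<and> t \<le> inverse (real (Suc n)) \<longrightarrow> norm (S t) \<le> real n)"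
        using neg by blast
      then show ?thesis by (auto simp: not_le)
    qed
    then obtain h where h: "\<And>n. 0 \<le> h n" "\<And>n. h n \<le> inverse (real (Suc n))" "\<And>n. norm (S (h n)) > real n"
      by metis
    have "h \<longlonglongrightarrow> 0"
      by (rule tendsto_sandwich[OF _ _ tendsto_const LIMSEQ_inverse_real_of_nat]) (use h in auto)
    then have conv: "(\<lambda>n. S (h n) x) \<longlonglongrightarrow> x" for x
      using C0_semigroup_seq[OF S] h(1) by blast
    have "\<exists>K. \<forall>n\<in>UNIV. norm (S (h n) x) \<le> K" for x
      using convergent_imp_Bseq[OF convergentI[OF conv[of x]]] by (auto simp: Bseq_def)
    then have "\<exists>K. \<forall>n\<in>UNIV. norm (S (h n)) \<le> K"
      by (rule uniform_boundedness)
    then obtain K where K: "\<And>n. norm (S (h n)) \<le> K" by blast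
    obtain n :: nat where "K < real n" using reals_Archimedean2 by blast
    with K[of n] h(3)[of n] show False by simp
  qed
  then show ?thesis using that by blast
qed

text \<open>The bound near 0 is propagated over successive windows of length \<open>\<delta>\<close>
  by the semigroup law.\<close>

lemma C0_semigroup_bounded:
  assumes S: "C0_semigroup S"
  obtains K where "K \<ge> 0" "\<And>t. 0 \<le> t \<Longrightarrow> t \<le> T \<Longrightarrow> norm (S t) \<le> K"
proof -
  obtain \<delta> K where \<delta>: "\<delta> > 0" and K: "\<And>t. 0 \<le> t \<Longrightarrow> t \<le> \<delta> \<Longrightarrow> norm (S t) \<le> K"
    using C0_semigroup_bounded_near_0[OF S] by blast
  have "\<exists>C\<ge>0. \<forall>t. 0 \<le> t \<and> t \<le> real n * \<delta> \<longrightarrow> norm (S t) \<le> C" for n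
  proof (induction n)
    case 0
    show ?case by (intro exI[of _ "norm (S 0)"]) auto
  next
    case (Suc n)
    then obtain C where C: "C \<ge> 0" "\<And>t. 0 \<le> t \<Longrightarrow> t \<le> real n * \<delta> \<Longrightarrow> norm (S t) \<le> C"
      by blast
    have K0: "K \<ge> 0" using K[of 0] \<delta> norm_ge_zero[of "S 0"] by linarith
    \<comment> \<open>The sum dominates both \<open>C\<close>, valid on the earlier windows, and
      \<open>K * C\<close>, valid on the new one.\<close>
    have "norm (S t) \<le> C + K * C" if t: "0 \<le> t" "t \<le> real (Suc n) * \<delta>" for t
    proof (cases "t \<le> real n * \<delta>")
      case True
      then show ?thesis using C t K0 by (simp add: add_increasing2)
    next
      case False
      define s where "s = real n * \<delta>"
      have s: "0 \<le> s" "0 \<le> t - s" "t - s \<le> \<delta>"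
        using False t \<delta> by (auto simp: s_def algebra_simps)
      have "S t = S (t - s) o\<^sub>L S s" using C0_semigroup_add[OF S s(2,1)] by simp
      then have "norm (S t) \<le> norm (S (t - s)) * norm (S s)" by (simp add: norm_blinfun_compose)
      also have "\<dots> \<le> K * C"
        using K[OF s(2,3)] C(2)[of s] s(1) K0 by (intro mult_mono) (auto simp: s_def)
      finally show ?thesis using C by simp
    qed
    then show ?case using C K0 by (intro exI[of _ "C + K * C"]) auto
  qed
  moreover obtain n :: nat where "T / \<delta> \<le> real n" using real_arch_simple by blast
  ultimately obtain C where C: "C \<ge> 0" "\<And>t. 0 \<le> t \<and> t \<le> real n * \<delta> \<Longrightarrow> norm (S t) \<le> C"
    by blast
  have "T \<le> real n * \<delta>" using \<open>T / \<delta> \<le> real n\<close> \<delta> by (simp add: field_simps)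
  with C show ?thesis by (intro that[of C]) auto
qed

text \<open>Continuity from the left comes from factoring out the earlier of two times: the
  increment is then controlled by the behaviour of \<open>S\<close> at 0 and the local bound
  \<open>K\<close>.\<close>

lemma C0_semigroup_continuous_on:
  assumes S: "C0_semigroup S"
  shows "continuous_on {0..T} (\<lambda>t. blinfun_apply (S t) x)"
proof -
  obtain K where K: "K \<ge> 0" "\<And>t. 0 \<le> t \<Longrightarrow> t \<le> T \<Longrightarrow> norm (S t) \<le> K"
    using C0_semigroup_bounded[OF S] by blast
  have diff: "norm (S b x - S a x) \<le> K * norm (S (b - a) x - x)" if "0 \<le> a" "a \<le> b" "b \<le> T" for a b
  proof -
    have "S b x = S a (S (b - a) x)"
      using C0_semigroup_add_apply[OF S, of a "b - a"] that by simp
    then have "S b x - S a x = S a (S (b - a) x - x)"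
      by (simp add: blinfun.diff_right)
    then have "norm (S b x - S a x) \<le> norm (S a) * norm (S (b - a) x - x)"
      by (simp add: norm_blinfun)
    also have "\<dots> \<le> K * norm (S (b - a) x - x)"
      using K(2)[of a] that by (intro mult_right_mono) auto
    finally show ?thesis .
  qed
  show ?thesis
    unfolding continuous_on_sequentially
  proof (intro ballI allI impI, elim conjE)
    fix s t assume t: "t \<in> {0..T}" and s: "\<forall>n. s n \<in> {0..T}" "s \<longlonglongrightarrow> t"
    have le: "norm (S (s n) x - S t x) \<le> K * norm (S \<bar>s n - t\<bar> x - x)" for n
      using diff[of t "s n"] diff[of "s n" t] s(1) t
      by (cases "t \<le> s n") (auto simp: norm_minus_commute abs_if)
    have "(\<lambda>n. \<bar>s n - t\<bar>) \<longlonglongrightarrow> 0"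
      using s(2) by (simp add: LIM_zero_iff tendsto_rabs_zero)
    then have "(\<lambda>n. S \<bar>s n - t\<bar> x) \<longlonglongrightarrow> x"
      by (intro C0_semigroup_seq[OF S]) auto
    then have "(\<lambda>n. K * norm (S \<bar>s n - t\<bar> x - x)) \<longlonglongrightarrow> K * 0"
      by (intro tendsto_mult_left tendsto_norm_zero LIM_zero)
    then have "(\<lambda>n. K * norm (S \<bar>s n - t\<bar> x - x)) \<longlonglongrightarrow> 0" by simp
    with always_eventually[OF allI[OF le]] have "(\<lambda>n. S (s n) x - S t x) \<longlonglongrightarrow> 0"
      by (rule Lim_null_comparison)
    then show "((\<lambda>t. S t x) \<circ> s) \<longlonglongrightarrow> S t x"
      by (simp add: LIM_zero_iff o_def)
  qed
qed

section \<open>A mean value argument with right derivatives\<close>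

text \<open>For a slope \<open>e > 0\<close>, take the last point \<open>c\<close> with
  \<open>norm (f c - f a) \<le> e * (c - a)\<close>. If \<open>c < b\<close>, the vanishing right
  derivative at \<open>c\<close> carries the inequality beyond \<open>c\<close>; hence
  \<open>c = b\<close>. Then \<open>e\<close> is made arbitrarily small.\<close>

lemma right_derivative_zero_imp_const:
  fixes f :: "real \<Rightarrow> 'a::real_normed_vector"
  assumes ab: "a \<le> b" and cont: "continuous_on {a..b} f"
    and deriv: "\<And>x. a \<le> x \<Longrightarrow> x < b \<Longrightarrow> ((\<lambda>h. (f (x + h) - f x) /\<^sub>R h) \<longlongrightarrow> 0) (at_right 0)"
  shows "f b = f a"
proof -
  have bound: "norm (f b - f a) \<le> e * (b - a)" if e: "e > 0" for e
  proof -
    define A where "A = {x \<in> {a..b}. norm (f x - f a) \<le> e * (x - a)}"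
    have "closed A"
      unfolding A_def
      by (rule continuous_on_closed_Collect_le) (auto intro!: continuous_intros cont)
    then have "compact ({a..b} \<inter> A)"
      by (intro compact_Int_closed) simp_all
    moreover have "{a..b} \<inter> A = A" by (auto simp: A_def)
    ultimately have "compact A" by simp
    moreover have "a \<in> A" using ab by (simp add: A_def)
    ultimately obtain c where c: "c \<in> A" "\<And>x. x \<in> A \<Longrightarrow> x \<le> c"
      using compact_attains_sup[of A] by blast
    have "c = b"
    proof (rule ccontr)
      assume "c \<noteq> b"
      with c(1) have cab: "a \<le> c" "c < b" by (auto simp: A_def)
      have "\<forall>\<^sub>F h in at_right 0. norm ((f (c + h) - f c) /\<^sub>R h) < e"
        using tendstoD[OF deriv[OF cab] e] by (simp add: dist_norm)
      moreover have "\<forall>\<^sub>F h in at_right 0. h < b - c"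
        using cab by (intro order_tendstoD(2)[OF tendsto_ident_at]) simp
      moreover have "\<forall>\<^sub>F h in at_right (0::real). h > 0"
        by (rule eventually_at_right_less)
      ultimately have "\<forall>\<^sub>F h in at_right 0. c + h \<in> A \<and> h > 0"
      proof eventually_elim
        case (elim h)
        then have "norm (f (c + h) - f c) / h < e"
          by (simp add: divide_inverse_commute)
        then have "norm (f (c + h) - f c) \<le> e * h"
          using elim by (simp add: pos_divide_less_eq)
        moreover have "norm (f c - f a) \<le> e * (c - a)"
          using c(1) by (simp add: A_def)
        moreover have "norm (f (c + h) - f a) \<le> norm (f (c + h) - f c) + norm (f c - f a)"
          using norm_triangle_ineq[of "f (c + h) - f c" "f c - f a"] by simp
        ultimately have "norm (f (c + h) - f a) \<le> e * (c + h - a)"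
          by (simp add: algebra_simps)
        then show ?case using elim cab by (simp add: A_def)
      qed
      then obtain h where "c + h \<in> A" "h > 0"
        using eventually_happens'[OF trivial_limit_at_right_real] by auto
      with c(2)[of "c + h"] show False by simp
    qed
    with c(1) show ?thesis by (simp add: A_def)
  qed
  have "norm (f b - f a) \<le> 0"
  proof (rule field_le_epsilon)
    fix e :: real assume e: "e > 0"
    \<comment> \<open>The summand 1 avoids division by zero when \<open>a = b\<close>.\<close>
    have "norm (f b - f a) \<le> e / (b - a + 1) * (b - a)"
      using bound[of "e / (b - a + 1)"] e ab by simp
    also have "\<dots> \<le> e" using e ab by (simp add: field_simps)
    finally show "norm (f b - f a) \<le> 0 + e" by simp
  qed
  then show ?thesis by simp
qed

section \<open>Generators: invariance and density of the domain\<close>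

text \<open>Describes the graph of the generator in one formula, by uniqueness of limits: exhibiting
  a limit of the difference quotient settles membership and value together.\<close>

lemma generates_iff:
  assumes "generates D A S"
  shows "x \<in> D \<and> A x = y \<longleftrightarrow> ((\<lambda>t. (blinfun_apply (S t) x - x) /\<^sub>R t) \<longlongrightarrow> y) (at_right 0)"
proof -
  have D: "D = {x. \<exists>y. ((\<lambda>t. (S t x - x) /\<^sub>R t) \<longlongrightarrow> y) (at_right 0)}"
    and A: "\<And>x. x \<in> D \<Longrightarrow> ((\<lambda>t. (S t x - x) /\<^sub>R t) \<longlongrightarrow> A x) (at_right 0)"
    using assms by (auto simp: generates_def)
  show ?thesis
  proof
    assume lim: "((\<lambda>t. (S t x - x) /\<^sub>R t) \<longlongrightarrow> y) (at_right 0)"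
    then have "x \<in> D" using D by blast
    with tendsto_unique[OF trivial_limit_at_right_real A lim] show "x \<in> D \<and> A x = y" by blast
  qed (use A in auto)
qed

text \<open>\<open>S t\<close> commutes with the difference quotient at 0 and, being continuous,
  carries its limit along.\<close>

lemma generates_invariant:
  assumes gen: "generates D A S" and x: "x \<in> D" and t: "t \<ge> 0"
  shows "blinfun_apply (S t) x \<in> D"
proof -
  have S: "C0_semigroup S" using gen by (simp add: generates_def)
  have "((\<lambda>h. (S h x - x) /\<^sub>R h) \<longlongrightarrow> A x) (at_right 0)"
    using generates_iff[OF gen] x by blast
  then have "((\<lambda>h. S t ((S h x - x) /\<^sub>R h)) \<longlongrightarrow> S t (A x)) (at_right 0)"
    by (rule blinfun.tendsto[OF tendsto_const])
  moreover have "\<forall>\<^sub>F h in at_right 0. S t ((S h x - x) /\<^sub>R h) = (S h (S t x) - S t x) /\<^sub>R h"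
    using eventually_at_right_less[of "0::real"]
    by eventually_elim (simp add: blinfun.bilinear_simps C0_semigroup_commute[OF S t])
  ultimately have "((\<lambda>h. (S h (S t x) - S t x) /\<^sub>R h) \<longlongrightarrow> S t (A x)) (at_right 0)"
    by (rule Lim_transform_eventually)
  then show ?thesis using generates_iff[OF gen] by blast
qed

text \<open>The fundamental theorem of calculus, recast as the one-sided difference quotient in
  which generators are defined.\<close>

lemma integral_right_derivative:
  fixes f :: "real \<Rightarrow> 'a::banach"
  assumes f: "continuous_on {0..b} f" and x: "0 \<le> x" "x < b"
  shows "((\<lambda>r. (integral {0..x + r} f - integral {0..x} f) /\<^sub>R r) \<longlongrightarrow> f x) (at_right 0)"
proof -
  define F where "F u = integral {0..u} f" for u
  have "(F has_vector_derivative f x) (at x within {0..b})"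
    unfolding F_def using x by (intro integral_has_vector_derivative f) auto
  \<comment> \<open>Shrinking the interval to start at \<open>x\<close> turns the filter into
    \<open>at_right x\<close>, which is then shifted to 0.\<close>
  then have "(F has_vector_derivative f x) (at x within {x..b})"
    by (rule has_vector_derivative_within_subset) (use x in auto)
  then have "((\<lambda>y. (1 / norm (y - x)) *\<^sub>R (F y - (F x + (y - x) *\<^sub>R f x))) \<longlongrightarrow> 0) (at_right x)"
    using x by (simp add: has_vector_derivative_def has_derivative_within at_within_Icc_at_right)
  then have "((\<lambda>r. (1 / norm r) *\<^sub>R (F (r + x) - (F x + r *\<^sub>R f x))) \<longlongrightarrow> 0) (at_right 0)"
    by (subst (asm) filterlim_at_right_to_0) simp
  then have "((\<lambda>r. (1 / norm r) *\<^sub>R (F (r + x) - (F x + r *\<^sub>R f x)) + f x) \<longlongrightarrow> 0 + f x) (at_right 0)"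
    by (intro tendsto_add tendsto_const)
  moreover have "\<forall>\<^sub>F r in at_right 0. (1 / norm r) *\<^sub>R (F (r + x) - (F x + r *\<^sub>R f x)) + f x
      = (F (x + r) - F x) /\<^sub>R r"
    using eventually_at_right_less[of "0::real"]
    by eventually_elim (simp add: scaleR_diff_right scaleR_add_right inverse_eq_divide add.commute)
  ultimately have "((\<lambda>r. (F (x + r) - F x) /\<^sub>R r) \<longlongrightarrow> 0 + f x) (at_right 0)"
    by (rule Lim_transform_eventually)
  then show ?thesis by (simp add: F_def)
qed

text \<open>With \<open>F\<close> the integral from 0, the semigroup law gives
  \<open>S r (F h) = F (h + r) - F r\<close>. So the quotient of the semigroup at \<open>F h\<close>
  is the difference of the right difference quotients of \<open>F\<close> at \<open>h\<close> and at
  0.\<close>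

lemma generates_integral_in_domain:
  assumes gen: "generates D A S" and h: "h > 0"
  shows "integral {0..h} (\<lambda>s. blinfun_apply (S s) x) \<in> D"
proof -
  have S: "C0_semigroup S" using gen by (simp add: generates_def)
  define f where "f s = S s x" for s
  have cont: "continuous_on {0..b} f" for b
    unfolding f_def by (rule C0_semigroup_continuous_on[OF S])
  define F where "F u = integral {0..u} f" for u
  have int: "f integrable_on {a..b}" if "0 \<le> a" for a b
    using that by (intro integrable_continuous_real continuous_on_subset[OF cont[of b]]) auto
  have shift: "S r (F h) = F (h + r) - F r" if r: "r > 0" for r
  proof -
    have "S r (F h) = integral {0..h} (blinfun_apply (S r) \<circ> f)"
      unfolding F_def using int[of 0 h]
      by (intro integral_linear[symmetric] blinfun.bounded_linear_right) simp
    also have "\<dots> = integral {0..h} (f \<circ> ((+) r))"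
      using r by (intro integral_cong) (simp add: f_def C0_semigroup_add_apply[OF S])
    also have "\<dots> = integral {r..h + r} f"
      by (simp add: integral_shift_Icc_real)
    also have "\<dots> = F (h + r) - F r"
      unfolding F_def using Henstock_Kurzweil_Integration.integral_combine[where a = 0 and c = r and b = "h + r" and f = f] r h int[of 0 "h + r"] by (simp add: algebra_simps)
    finally show ?thesis .
  qed
  have "F 0 = 0" by (simp add: F_def)
  have "((\<lambda>r. (F (h + r) - F h) /\<^sub>R r - (F (0 + r) - F 0) /\<^sub>R r) \<longlongrightarrow> f h - f 0) (at_right 0)"
    unfolding F_def using h
    by (intro tendsto_diff integral_right_derivative[OF cont[of "h + 1"]]) auto
  moreover have "\<forall>\<^sub>F r in at_right 0. (F (h + r) - F h) /\<^sub>R r - (F (0 + r) - F 0) /\<^sub>R r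
      = (S r (F h) - F h) /\<^sub>R r"
    using eventually_at_right_less[of "0::real"]
    by eventually_elim (simp add: shift \<open>F 0 = 0\<close> scaleR_diff_right)
  ultimately have "((\<lambda>r. (S r (F h) - F h) /\<^sub>R r) \<longlongrightarrow> f h - f 0) (at_right 0)"
    by (rule Lim_transform_eventually)
  then have "F h \<in> D" using generates_iff[OF gen] by blast
  then show ?thesis by (simp add: F_def f_def[abs_def])
qed

lemma generates_domain_scaleR:
  assumes gen: "generates D A S" and x: "x \<in> D"
  shows "c *\<^sub>R x \<in> D"
proof -
  have "((\<lambda>t. (S t x - x) /\<^sub>R t) \<longlongrightarrow> A x) (at_right 0)"
    using generates_iff[OF gen] x by blast
  then have "((\<lambda>t. c *\<^sub>R ((S t x - x) /\<^sub>R t)) \<longlongrightarrow> c *\<^sub>R A x) (at_right 0)"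
    by (intro tendsto_scaleR tendsto_const)
  then have "((\<lambda>t. (S t (c *\<^sub>R x) - c *\<^sub>R x) /\<^sub>R t) \<longlongrightarrow> c *\<^sub>R A x) (at_right 0)"
    by (simp add: blinfun.bilinear_simps scaleR_diff_right mult.commute)
  then show ?thesis using generates_iff[OF gen] by blast
qed

text \<open>The averages of \<open>s \<mapsto> S s x\<close> over \<open>{0..r}\<close> lie in the
  domain and tend to \<open>S 0 x = x\<close>.\<close>

lemma generates_domain_dense:
  assumes gen: "generates D A S"
  shows "closure D = UNIV"
proof -
  have S: "C0_semigroup S" using gen by (simp add: generates_def)
  have "x \<in> closure D" for x
  proof -
    define g where "g r = (1 / r) *\<^sub>R integral {0..r} (\<lambda>s. S s x)" for r
    have "((\<lambda>r. (integral {0..0 + r} (\<lambda>s. S s x) - integral {0..0} (\<lambda>s. S s x)) /\<^sub>R r) \<longlongrightarrow> S 0 x) (at_right 0)"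
      by (intro integral_right_derivative[OF C0_semigroup_continuous_on[OF S, where T = 1]]) auto
    then have lim: "(g \<longlongrightarrow> x) (at_right 0)"
      by (simp add: g_def[abs_def] inverse_eq_divide C0_semigroup_id[OF S])
    have "\<forall>\<^sub>F r in at_right 0. g r \<in> D"
      using eventually_at_right_less[of "0::real"]
      by eventually_elim
        (simp add: g_def generates_domain_scaleR[OF gen] generates_integral_in_domain[OF gen])
    then have "\<forall>\<^sub>F r in at_right 0. g r \<in> closure D"
      by eventually_elim (use closure_subset in blast)
    then show ?thesis
      using Lim_in_closed_set[OF closed_closure _ trivial_limit_at_right_real lim] by blast
  qed
  then show ?thesis by blast
qed

section \<open>Intertwining of the two semigroups\<close>

text \<open>Joint continuity in time and vector: the local bound handles the error
  \<open>w n - y\<close>, strong continuity the fixed vector \<open>y\<close>. It is needed for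
  curves in which both vary.\<close>

lemma C0_semigroup_tendsto_apply:
  assumes S: "C0_semigroup S" and s: "\<And>n. 0 \<le> s n" "s \<longlonglongrightarrow> t"
    and w: "w \<longlonglongrightarrow> y"
  shows "(\<lambda>n. blinfun_apply (S (s n)) (w n)) \<longlonglongrightarrow> blinfun_apply (S t) y"
proof -
  obtain T where T: "\<And>n. \<bar>s n\<bar> \<le> T"
    using convergent_imp_Bseq[OF convergentI[OF s(2)]] by (auto simp: Bseq_def)
  obtain K where K: "K \<ge> 0" "\<And>t. 0 \<le> t \<Longrightarrow> t \<le> T \<Longrightarrow> norm (S t) \<le> K"
    using C0_semigroup_bounded[OF S] by blast
  have "s n \<in> {0..T}" for n using s(1)[of n] T[of n] by auto
  moreover have "t \<in> {0..T}"
    by (rule closed_sequentially[OF closed_atLeastAtMost _ s(2)]) fact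
  ultimately have lim: "(\<lambda>n. S (s n) y) \<longlonglongrightarrow> S t y"
    using continuous_on_tendsto_compose[OF C0_semigroup_continuous_on[OF S, of T y] s(2)] by simp
  have le: "norm (S (s n) (w n - y)) \<le> K * norm (w n - y)" for n
  proof -
    have "norm (S (s n) (w n - y)) \<le> norm (S (s n)) * norm (w n - y)" by (rule norm_blinfun)
    also have "\<dots> \<le> K * norm (w n - y)"
      using K(2)[of "s n"] s(1)[of n] T[of n] by (intro mult_right_mono) auto
    finally show ?thesis .
  qed
  have "(\<lambda>n. K * norm (w n - y)) \<longlonglongrightarrow> K * 0"
    by (intro tendsto_mult_left tendsto_norm_zero LIM_zero w)
  then have "(\<lambda>n. K * norm (w n - y)) \<longlonglongrightarrow> 0" by simp
  with always_eventually[OF allI[OF le]] have "(\<lambda>n. S (s n) (w n - y)) \<longlonglongrightarrow> 0"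
    by (rule Lim_null_comparison)
  from tendsto_add[OF this lim] show ?thesis
    by (simp add: blinfun.diff_right)
qed

text \<open>The right derivative of \<open>s \<mapsto> S (t - s) (Y (S' s g))\<close> vanishes because both semigroups
  move \<open>Y (S' s g)\<close> with the velocity \<open>A (Y (S' s g))\<close>. Left derivatives, which would need
  a further argument, are not required for constancy.\<close>

lemma semigroup_intertwine:
  assumes gen: "generates D A S" and gen': "generates D' A' S'"
    and YA: "\<And>g. g \<in> D' \<Longrightarrow> blinfun_apply Y g \<in> D \<and> blinfun_apply Y (A' g) = A (blinfun_apply Y g)"
    and t: "t \<ge> 0"
  shows "Y o\<^sub>L S' t = S t o\<^sub>L Y"
proof -
  have S: "C0_semigroup S" and S': "C0_semigroup S'"
    using gen gen' by (simp_all add: generates_def)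
  obtain K where K: "K \<ge> 0" "\<And>s. 0 \<le> s \<Longrightarrow> s \<le> t \<Longrightarrow> norm (S s) \<le> K"
    using C0_semigroup_bounded[OF S] by blast
  have on_domain: "Y (S' t g) = S t (Y g)" if g: "g \<in> D'" for g
  proof -
    define \<phi> where "\<phi> s = S (t - s) (Y (S' s g))" for s
    have "\<phi> t = \<phi> 0"
    proof (rule right_derivative_zero_imp_const[OF t])
      show "continuous_on {0..t} \<phi>"
        unfolding continuous_on_sequentially
      proof (intro ballI allI impI, elim conjE)
        fix s r assume r: "r \<in> {0..t}" and s: "\<forall>n. s n \<in> {0..t}" "s \<longlonglongrightarrow> r"
        have "(\<lambda>n. S' (s n) g) \<longlonglongrightarrow> S' r g"
          using s by (intro C0_semigroup_tendsto_apply[OF S' _ s(2) tendsto_const]) auto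
        then have "(\<lambda>n. Y (S' (s n) g)) \<longlonglongrightarrow> Y (S' r g)"
          by (rule blinfun.tendsto[OF tendsto_const])
        moreover have "(\<lambda>n. t - s n) \<longlonglongrightarrow> t - r"
          by (intro tendsto_diff tendsto_const s(2))
        ultimately show "(\<phi> \<circ> s) \<longlonglongrightarrow> \<phi> r"
          unfolding \<phi>_def o_def using s(1) by (intro C0_semigroup_tendsto_apply[OF S]) auto
      qed
    next
      fix s assume s: "0 \<le> s" "s < t"
      define k where "k = S' s g"
      have k: "k \<in> D'" unfolding k_def by (rule generates_invariant[OF gen' g s(1)])
      have "((\<lambda>h. (S' h k - k) /\<^sub>R h) \<longlongrightarrow> A' k) (at_right 0)"
        using generates_iff[OF gen'] k by blast
      then have "((\<lambda>h. Y ((S' h k - k) /\<^sub>R h)) \<longlongrightarrow> Y (A' k)) (at_right 0)"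
        by (rule blinfun.tendsto[OF tendsto_const])
      \<comment> \<open>The relation between the generators enters here: \<open>Y k\<close> lies in
        \<open>D\<close>, with \<open>A (Y k) = Y (A' k)\<close>.\<close>
      moreover have "((\<lambda>h. (S h (Y k) - Y k) /\<^sub>R h) \<longlongrightarrow> Y (A' k)) (at_right 0)"
        using generates_iff[OF gen] YA[OF k] by metis
      ultimately have "((\<lambda>h. Y ((S' h k - k) /\<^sub>R h) - (S h (Y k) - Y k) /\<^sub>R h) \<longlongrightarrow> Y (A' k) - Y (A' k)) (at_right 0)"
        by (rule tendsto_diff)
      then have "((\<lambda>h. (Y (S' h k) - S h (Y k)) /\<^sub>R h) \<longlongrightarrow> 0) (at_right 0)"
        by (simp add: blinfun.bilinear_simps scaleR_diff_right)
      then have "((\<lambda>h. norm ((Y (S' h k) - S h (Y k)) /\<^sub>R h)) \<longlongrightarrow> 0) (at_right 0)"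
        by (rule tendsto_norm_zero)
      from tendsto_mult_left[OF this, of K]
      have lim: "((\<lambda>h. K * norm ((Y (S' h k) - S h (Y k)) /\<^sub>R h)) \<longlongrightarrow> 0) (at_right 0)"
        by simp
      have "\<forall>\<^sub>F h in at_right 0. h < t - s"
        using s by (intro order_tendstoD(2)[OF tendsto_ident_at]) simp
      then have "\<forall>\<^sub>F h in at_right 0. norm ((\<phi> (s + h) - \<phi> s) /\<^sub>R h)
          \<le> K * norm ((Y (S' h k) - S h (Y k)) /\<^sub>R h)"
        using eventually_at_right_less[of "0::real"]
      proof eventually_elim
        case (elim h)
        have "S' (s + h) g = S' h k"
          unfolding k_def using C0_semigroup_add_apply[OF S', of h s g] elim s by (simp add: add.commute)
        moreover have "S (t - s) y = S (t - (s + h)) (S h y)" for y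
          using C0_semigroup_add_apply[OF S, of "t - (s + h)" h y] elim s by simp
        \<comment> \<open>Factoring out \<open>S (t - (s + h))\<close>, of norm at most
          \<open>K\<close>, leaves a quotient already known to vanish as \<open>h\<close> tends to
          0.\<close>
        ultimately have "(\<phi> (s + h) - \<phi> s) /\<^sub>R h = S (t - (s + h)) ((Y (S' h k) - S h (Y k)) /\<^sub>R h)"
          by (simp add: \<phi>_def k_def[symmetric] blinfun.bilinear_simps)
        then have "norm ((\<phi> (s + h) - \<phi> s) /\<^sub>R h)
            \<le> norm (S (t - (s + h))) * norm ((Y (S' h k) - S h (Y k)) /\<^sub>R h)"
          by (metis norm_blinfun)
        also have "\<dots> \<le> K * norm ((Y (S' h k) - S h (Y k)) /\<^sub>R h)"
          using elim s by (intro mult_right_mono K) auto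
        finally show ?case .
      qed
      then show "((\<lambda>h. (\<phi> (s + h) - \<phi> s) /\<^sub>R h) \<longlongrightarrow> 0) (at_right 0)"
        using lim by (rule Lim_null_comparison)
    qed
    then show ?thesis
      by (simp add: \<phi>_def C0_semigroup_id[OF S] C0_semigroup_id[OF S'])
  qed
  show ?thesis
  proof (rule blinfun_eqI)
    fix x
    \<comment> \<open>Both sides are continuous in \<open>x\<close>, so equality extends from the
      dense set \<open>D'\<close>.\<close>
    have "closed {x. Y (S' t x) = S t (Y x)}"
      by (intro closed_Collect_eq continuous_intros)
    then have "closure D' \<subseteq> {x. Y (S' t x) = S t (Y x)}"
      using on_domain by (intro closure_minimal) auto
    then have "Y (S' t x) = S t (Y x)"
      using generates_domain_dense[OF gen'] by blast
    then show "(Y o\<^sub>L S' t) x = (S t o\<^sub>L Y) x" by simp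
  qed
qed

section \<open>Controls\<close>

text \<open>The bounded operator \<open>c *\<^sub>R Y\<close> is applied to the identity for the
  final state, and the relations for \<open>S\<close> and \<open>B\<close> rewrite the integrand.
  The scalar \<open>c\<close> allows initial values to be normalised when costs are
  compared.\<close>

lemma steers_to_zero_transfer:
  fixes S :: "real \<Rightarrow> 'h::banach \<Rightarrow>\<^sub>L 'h" and S' :: "real \<Rightarrow> 'h2::banach \<Rightarrow>\<^sub>L 'h2"
    and B :: "'u::banach \<Rightarrow>\<^sub>L 'h" and B' :: "'u2::banach \<Rightarrow>\<^sub>L 'h2"
  assumes intertwine: "\<And>t. t \<ge> 0 \<Longrightarrow> Y o\<^sub>L S' t = S t o\<^sub>L Y" and YB: "Y o\<^sub>L B' = B o\<^sub>L Z"
    and T: "T > 0" and steer: "steers_to_zero S' B' T u0 v"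
  shows "steers_to_zero S B T (c *\<^sub>R blinfun_apply Y u0) (\<lambda>s. blinfun_apply (c *\<^sub>R Z) (v s))"
proof -
  obtain J where J: "has_strong_integral (lebesgue_on {0<..<T}) (\<lambda>s. S' (T - s) (B' (v s))) J"
    "S' T u0 + J = 0"
    using steer unfolding steers_to_zero_def by blast
  have YS: "Y (S' t x) = S t (Y x)" if "t \<ge> 0" for t x
    using intertwine[OF that] by (metis blinfun_apply_blinfun_compose)
  have YBZ: "Y (B' x) = B (Z x)" for x
    using YB by (metis blinfun_apply_blinfun_compose)
  have "has_strong_integral (lebesgue_on {0<..<T}) (\<lambda>s. (c *\<^sub>R Y) (S' (T - s) (B' (v s)))) ((c *\<^sub>R Y) J)"
    by (intro has_strong_integral_blinfun complete_measure_lebesgue_on J(1)) simp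
  then have "has_strong_integral (lebesgue_on {0<..<T}) (\<lambda>s. S (T - s) (B ((c *\<^sub>R Z) (v s)))) ((c *\<^sub>R Y) J)"
    \<comment> \<open>The integrand is rewritten only on \<open>{0<..<T}\<close>, where
      \<open>T - s \<ge> 0\<close> makes the intertwining relation available.\<close>
    by (subst has_strong_integral_cong[symmetric, rotated]) (auto simp: YS YBZ blinfun.bilinear_simps)
  moreover have "S T (c *\<^sub>R Y u0) + (c *\<^sub>R Y) J = (c *\<^sub>R Y) (S' T u0 + J)"
    using T by (simp add: blinfun.bilinear_simps YS scaleR_add_right)
  ultimately show ?thesis
    unfolding steers_to_zero_def using J(2) by (auto simp: blinfun.zero_right)
qed

section \<open>Positivity of the control cost\<close>

text \<open>A lower bound on controls: the integral has to cancel \<open>S T u0\<close>, and its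
  norm is at most a constant times the L^1 norm of \<open>v\<close>.\<close>

lemma steers_to_zero_norm_bound:
  fixes S :: "real \<Rightarrow> 'h::banach \<Rightarrow>\<^sub>L 'h" and B :: "'u::banach \<Rightarrow>\<^sub>L 'h"
  assumes K: "K \<ge> 0" "\<And>t. 0 \<le> t \<Longrightarrow> t \<le> T \<Longrightarrow> norm (S t) \<le> K"
    and v: "strongly_measurable (lebesgue_on {0<..<T}) v" and steer: "steers_to_zero S B T u0 v"
  shows "ennreal (norm (blinfun_apply (S T) u0))
    \<le> ennreal (K * norm B) * (\<integral>\<^sup>+ s. ennreal (norm (v s)) \<partial>lebesgue_on {0<..<T})"
proof -
  let ?M = "lebesgue_on {0<..<T}"
  have M: "complete_measure ?M" by (intro complete_measure_lebesgue_on) simp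
  have [measurable]: "(\<lambda>s. norm (v s)) \<in> borel_measurable ?M"
    by (intro borel_measurable_strongly_measurable_norm M v)
  obtain J where J: "has_strong_integral ?M (\<lambda>s. S (T - s) (B (v s))) J" "S T u0 + J = 0"
    using steer unfolding steers_to_zero_def by blast
  have "norm (S T u0) = norm J"
    using J(2) by (metis add_eq_0_iff norm_minus_cancel)
  then have "ennreal (norm (S T u0)) \<le> (\<integral>\<^sup>+ s. ennreal (norm (S (T - s) (B (v s)))) \<partial>?M)"
    using has_strong_integral_norm_bound[OF M J(1)] by simp
  also have "\<dots> \<le> (\<integral>\<^sup>+ s. ennreal (K * norm B) * ennreal (norm (v s)) \<partial>?M)"
  proof (intro nn_integral_mono)
    fix s assume "s \<in> space ?M"
    then have s: "0 \<le> T - s" "T - s \<le> T" by auto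
    have "norm (S (T - s) (B (v s))) \<le> norm (S (T - s)) * (norm B * norm (v s))"
      by (rule order_trans[OF norm_blinfun mult_left_mono[OF norm_blinfun]]) simp
    also have "\<dots> \<le> K * (norm B * norm (v s))"
      by (intro mult_right_mono K s) simp
    finally show "ennreal (norm (S (T - s) (B (v s)))) \<le> ennreal (K * norm B) * ennreal (norm (v s))"
      using K(1) by (simp add: mult.assoc flip: ennreal_mult)
  qed
  also have "\<dots> = ennreal (K * norm B) * (\<integral>\<^sup>+ s. ennreal (norm (v s)) \<partial>?M)"
    by (intro nn_integral_cmult) measurable
  finally show ?thesis .
qed

lemma control_cost_pos:
  fixes S :: "real \<Rightarrow> 'h::banach \<Rightarrow>\<^sub>L 'h" and B :: "'u::banach \<Rightarrow>\<^sub>L 'h"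
  assumes S: "C0_semigroup S" and p: "1 \<le> p" and ST: "S T \<noteq> 0"
  shows "control_cost S B T p > 0"
proof (rule ccontr)
  let ?M = "lebesgue_on {0<..<T}"
  assume "\<not> control_cost S B T p > 0"
  then have cost: "control_cost S B T p = 0" by simp
  obtain x where x: "S T x \<noteq> 0" using ST by (metis blinfun_eqI blinfun.zero_left)
  then have x0: "x \<noteq> 0" by (auto simp: blinfun.zero_right)
  define u0 where "u0 = x /\<^sub>R norm x"
  have u0: "norm u0 = 1" "S T u0 \<noteq> 0"
    using x x0 by (auto simp: u0_def blinfun.scaleR_right)
  have "(INF v\<in>{v \<in> Lp_space p ?M. steers_to_zero S B T u0 v}. Lp_norm p ?M v) \<le> control_cost S B T p"
    unfolding control_cost_def using u0(1) by (intro SUP_upper) simp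
  then have inf: "(INF v\<in>{v \<in> Lp_space p ?M. steers_to_zero S B T u0 v}. Lp_norm p ?M v) = 0"
    using cost by simp
  obtain K where K: "K \<ge> 0" "\<And>t. 0 \<le> t \<Longrightarrow> t \<le> T \<Longrightarrow> norm (S t) \<le> K"
    using C0_semigroup_bounded[OF S] by blast
  \<comment> \<open>The summand 1 makes \<open>C\<close> positive even if
    \<open>K * norm B = 0\<close>; \<open>\<delta>\<close> is then chosen so that
    \<open>C * \<delta>\<close> is half of \<open>norm (S T u0)\<close>, which yields the
    contradiction.\<close>
  define C where "C = K * norm B + 1"
  have C: "C > 0" using K by (simp add: C_def add_nonneg_pos)
  define \<delta> where "\<delta> = norm (S T u0) / (2 * C)"
  have \<delta>: "\<delta> > 0" using u0 C by (simp add: \<delta>_def)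
  have M: "complete_measure ?M" by (intro complete_measure_lebesgue_on) simp
  have "finite_measure ?M"
    by (intro finite_measure_lebesgue_on) simp
  from L1_small_if_Lp_small[OF M this p \<delta>] obtain \<epsilon> where \<epsilon>: "\<epsilon> > 0"
    "\<And>v :: real \<Rightarrow> 'u. v \<in> Lp_space p ?M \<Longrightarrow> Lp_norm p ?M v < ennreal \<epsilon> \<Longrightarrow>
      (\<integral>\<^sup>+ s. ennreal (norm (v s)) \<partial>?M) \<le> ennreal \<delta>"
    by metis
  \<comment> \<open>The infimum over an empty set would be \<infinity>, so a value below
    \<open>\<epsilon>\<close> really provides a control.\<close>
  have "(INF v\<in>{v \<in> Lp_space p ?M. steers_to_zero S B T u0 v}. Lp_norm p ?M v) < ennreal \<epsilon>"
    using inf \<epsilon>(1) by simp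
  then obtain v where v: "v \<in> Lp_space p ?M" "steers_to_zero S B T u0 v" "Lp_norm p ?M v < ennreal \<epsilon>"
    by (auto simp: INF_less_iff)
  have "ennreal (norm (S T u0)) \<le> ennreal (K * norm B) * (\<integral>\<^sup>+ s. ennreal (norm (v s)) \<partial>?M)"
    using v by (intro steers_to_zero_norm_bound K) (simp_all add: Lp_space_def)
  also have "\<dots> \<le> ennreal C * ennreal \<delta>"
    by (intro mult_mono \<epsilon>(2) v ennreal_leI) (simp_all add: C_def)
  also have "\<dots> = ennreal (C * \<delta>)" using C \<delta> by (simp add: ennreal_mult)
  finally have "norm (S T u0) \<le> C * \<delta>"
    using C \<delta> by (simp add: ennreal_le_iff)
  also have "\<dots> = norm (S T u0) / 2" using C by (simp add: \<delta>_def)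
  finally show False using u0(2) by simp
qed

section \<open>Comparison of the control costs\<close>

text \<open>For \<open>c > 0\<close> one divides by \<open>c\<close>. The case \<open>c = 0\<close>,
  as for \<open>Z = 0\<close>, relies on a member of \<open>A\<close>: over the empty set the
  right-hand side would be \<open>0 * \<infinity> = 0\<close>.\<close>

lemma le_cmult_INF_ennreal:
  fixes f :: "'a \<Rightarrow> ennreal"
  assumes A: "A \<noteq> {}" and c: "c < \<infinity>" and le: "\<And>x. x \<in> A \<Longrightarrow> a \<le> c * f x"
  shows "a \<le> c * (INF x\<in>A. f x)"
proof (cases "c = 0")
  case True
  obtain x where "x \<in> A" using A by blast
  with le[of x] True show ?thesis by simp
next
  case False
  then have "a / c \<le> (INF x\<in>A. f x)"
    by (intro INF_greatest divide_le_posI_ennreal le) (auto simp: zero_less_iff_neq_zero)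
  then have "a / c * c \<le> (INF x\<in>A. f x) * c"
    by (rule mult_right_mono) simp
  moreover have "a / c * c = a"
    using False c by (simp add: ennreal_divide_times)
  ultimately show ?thesis by (simp add: mult.commute)
qed

text \<open>Positivity is asserted for \<open>S T \<noteq> 0\<close> because it fails otherwise: if
  \<open>S T = 0\<close>, the zero control steers every initial value to zero and the cost is
  0.\<close>

theorem theorem3p1:
  fixes S :: "real \<Rightarrow> 'h::banach \<Rightarrow>\<^sub>L 'h" and S' :: "real \<Rightarrow> 'h2::banach \<Rightarrow>\<^sub>L 'h2"
    and DH :: "'h set" and H :: "'h \<Rightarrow> 'h"
    and DH' :: "'h2 set" and H' :: "'h2 \<Rightarrow> 'h2"
    and B :: "'u::banach \<Rightarrow>\<^sub>L 'h" and B' :: "'u2::banach \<Rightarrow>\<^sub>L 'h2"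
    and Y :: "'h2 \<Rightarrow>\<^sub>L 'h" and Yhat :: "'h \<Rightarrow>\<^sub>L 'h2" and Z :: "'u2 \<Rightarrow>\<^sub>L 'u"
    and T :: real and p :: ennreal
  assumes gen: "generates DH (\<lambda>x. - H x) S"
    and gen': "generates DH' (\<lambda>x. - H' x) S'"
    and T: "T > 0"
    and p: "1 \<le> p"
    and right_inverse: "Y o\<^sub>L Yhat = id_blinfun"
    and intertwine: "\<And>g. g \<in> DH' \<Longrightarrow>
      blinfun_apply Y g \<in> DH \<and> blinfun_apply Y (H' g) = H (blinfun_apply Y g)"
    and YB: "Y o\<^sub>L B' = B o\<^sub>L Z"
    and null': "null_controllable S' B' T p"
    and cost': "control_cost S' B' T p > 0"
  shows "null_controllable S B T p \<and>
    control_cost S B T p \<le> ennreal (norm Yhat * norm Z) * control_cost S' B' T p \<and>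
    (S T \<noteq> 0 \<longrightarrow> control_cost S B T p > 0)"
proof (intro conjI impI)
  let ?M = "lebesgue_on {0<..<T}"
  have M: "complete_measure ?M" by (intro complete_measure_lebesgue_on) simp
  have S: "C0_semigroup S" using gen by (simp add: generates_def)
  have YS: "Y o\<^sub>L S' t = S t o\<^sub>L Y" if "t \<ge> 0" for t
    using intertwine that by (intro semigroup_intertwine[OF gen gen']) (auto simp: blinfun.minus_right)
  have YYhat: "Y (Yhat u) = u" for u
    using right_inverse by (metis blinfun_apply_blinfun_compose blinfun_apply_id_blinfun)
  show "null_controllable S B T p"
    unfolding null_controllable_def
  proof
    fix u0
    obtain v where v: "v \<in> Lp_space p ?M" "steers_to_zero S' B' T (Yhat u0) v"
      using null' unfolding null_controllable_def by blast
    show "\<exists>v\<in>Lp_space p ?M. steers_to_zero S B T u0 v"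
    proof
      \<comment> \<open>The factor 1 matches the transfer lemma with \<open>c = 1\<close>, which
        applies directly because \<open>Y (Yhat u0) = u0\<close>.\<close>
      show "(\<lambda>s. (1 *\<^sub>R Z) (v s)) \<in> Lp_space p ?M"
        by (rule Lp_space_blinfun[OF M p v(1)])
      show "steers_to_zero S B T u0 (\<lambda>s. (1 *\<^sub>R Z) (v s))"
        using steers_to_zero_transfer[OF YS YB T v(2), of 1] by (simp add: YYhat)
    qed
  qed
  show "control_cost S B T p \<le> ennreal (norm Yhat * norm Z) * control_cost S' B' T p"
    unfolding control_cost_def[of S]
  proof (rule SUP_least)
    fix u0 :: 'h assume "u0 \<in> {u0. norm u0 = 1}"
    then have u0: "norm u0 = 1" by simp
    \<comment> \<open>The cost of the second system concerns unit vectors only, so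
      \<open>Yhat u0\<close> is normalised to \<open>w\<close>, and \<open>c\<close> is moved into
      the control. It is nonzero because \<open>Y\<close> maps \<open>Yhat u0\<close> to
      \<open>u0\<close>.\<close>
    define c where "c = norm (Yhat u0)"
    have "Yhat u0 \<noteq> 0"
      using YYhat[of u0] u0 by (auto simp: blinfun.zero_right)
    then have c: "c > 0" by (simp add: c_def)
    define w where "w = Yhat u0 /\<^sub>R c"
    have w: "norm w = 1" "c *\<^sub>R Y w = u0"
      using c by (auto simp: w_def blinfun.scaleR_right YYhat c_def)
    let ?V = "{v \<in> Lp_space p ?M. steers_to_zero S' B' T w v}"
    have "?V \<noteq> {}"
      using null' unfolding null_controllable_def by blast
    moreover have "(INF v\<in>{v \<in> Lp_space p ?M. steers_to_zero S B T u0 v}. Lp_norm p ?M v)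
        \<le> ennreal (norm Yhat * norm Z) * Lp_norm p ?M v" if v: "v \<in> ?V" for v
    proof -
      have sv: "steers_to_zero S' B' T w v" using v by simp
      let ?v = "\<lambda>s. (c *\<^sub>R Z) (v s)"
      have "?v \<in> Lp_space p ?M"
        using v by (intro Lp_space_blinfun[OF M p]) simp
      moreover have "steers_to_zero S B T u0 ?v"
        using steers_to_zero_transfer[OF YS YB T sv, of c] w(2) by simp
      ultimately have "(INF v\<in>{v \<in> Lp_space p ?M. steers_to_zero S B T u0 v}. Lp_norm p ?M v)
          \<le> Lp_norm p ?M ?v"
        by (intro INF_lower) simp
      also have "\<dots> \<le> ennreal (norm (c *\<^sub>R Z)) * Lp_norm p ?M v"
        using v by (intro Lp_norm_blinfun[OF M p]) simp
      \<comment> \<open>Since \<open>u0\<close> is a unit vector, \<open>c \<le> norm Yhat\<close>;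
        this is where the norm of the right inverse enters the estimate.\<close>
      also have "\<dots> \<le> ennreal (norm Yhat * norm Z) * Lp_norm p ?M v"
        using norm_blinfun[of Yhat u0] u0
        by (intro mult_right_mono ennreal_leI) (simp_all add: c_def mult_right_mono)
      finally show ?thesis .
    qed
    ultimately have "(INF v\<in>{v \<in> Lp_space p ?M. steers_to_zero S B T u0 v}. Lp_norm p ?M v)
        \<le> ennreal (norm Yhat * norm Z) * (INF v\<in>?V. Lp_norm p ?M v)"
      by (intro le_cmult_INF_ennreal) simp_all
    also have "(INF v\<in>?V. Lp_norm p ?M v) \<le> control_cost S' B' T p"
      unfolding control_cost_def using w(1) by (intro SUP_upper) simp
    finally show "(INF v\<in>{v \<in> Lp_space p ?M. steers_to_zero S B T u0 v}. Lp_norm p ?M v)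
        \<le> ennreal (norm Yhat * norm Z) * control_cost S' B' T p"
      by (simp add: mult_left_mono)
  qed
  show "control_cost S B T p > 0" if "S T \<noteq> 0"
    using control_cost_pos[OF S p that] .
qed

end
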